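(* Let $\mathcal{P}$ be a finite set of quasi-density properties and $\varphi$ a modal formula. If $\mathsf{contr}\in\mathcal{C}$ for every $\mathcal{C}\in\mathrm{Ch}(\mathcal{D}_\varphi,\mathcal{R}_\varphi\cup\mathcal{P})$, then $\overline{\varphi}$ is $\mathcal{P}$-valid.
   Context: Modal formulae are in negation normal form ($p,\neg p,\lor,\land,\Diamond,\Box$); $\overline\psi$ is the dual negation ($\overline p=\neg p$, $\overline{\neg p}=p$, swap $\lor/\land$ and $\Diamond/\Box$ recursively). A quasi-density property (QDP) is $\forall x,y\,(R^k(x,y)\to R^n(x,y))$ with $0<k<n$ ($R^\ell$ = existence of an $R$-path of length $\ell$); a $\mathcal P$-model is a Kripke model whose accessibility relation satisfies all QDPs in $\mathcal P$; $\psi$ is $\mathcal P$-valid if true at all worlds of all $\mathcal P$-models. Terms are words over disjoint countable sets of constants and variables; an instance is a (possibly infinite) set of atoms over terms. The signature has unary $P_\psi$ (for each subformula $\psi$ of $\varphi$), binary $R,E$ and nullary $\mathsf{contr}$. $\mathcal{D}_\varphi=\{P_\varphi(a)\}$ for a fixed constant $a$. Each QDP is the rule $R(x,y_1)\land\cdots\land R(y_{k-1},y)\to\exists z_1..z_{n-1}\,R(x,z_1)\land\cdots\land R(z_{n-1},y)$. $\mathcal R_\varphi$ consists of, for subformulae $\psi,\chi$ of $\varphi$: $P_{\psi\land\chi}(x)\to P_\psi(x)\land P_\chi(x)$; $P_{\psi\lor\chi}(x)\to P_\psi(x)\lor P_\chi(x)$; $P_{\Box\psi}(x)\land R(x,y)\to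 P_\psi(y)$; $P_{\Diamond\psi}(x)\to\exists y(R(x,y)\land E(x,y)\land P_\psi(y))$; $P_\psi(x)\land P_{\overline\psi}(x)\to\mathsf{contr}$. Disjunctive chase: a homomorphism maps terms to terms preserving atoms and fixing constants. A trigger in an instance $I$ is a pair $(\rho,h)$ with $h$ a homomorphism from the body of rule $\rho$ into $I$; it is active if there is no disjunct $\gamma$ of the head such that $h$ extends to a homomorphism of $\mathrm{body}(\rho)\land\gamma$ into $I$. Applying an active trigger yields the set of instances $I\cup\alpha(h(\vec y),\vec t)$, one for each disjunct $\exists\vec z\,\alpha(\vec y,\vec z)$ of the head, with $\vec t$ fresh terms. A fair derivation sequence of $I$ and a rule set $\mathcal R$ is a sequence $(I_i)$ with $I_0=I$, each $I_{i+1}$ in the application of some trigger in $I_i$, such that no trigger stays active indefinitely. $\mathrm{Ch}(I,\mathcal R)$ is the set of unions $\bigcup_i I_i$ over all fair derivation sequences. *)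

theory Defs
  imports Main "HOL-Library.Extended_Nat"
begin

subsection \<open>Modal formulae and Kripke semantics\<close>

datatype 'p form =
    Pos 'p
  | Neg 'p
  | Or "'p form" "'p form"
  | And "'p form" "'p form"
  | Dia "'p form"
  | Box "'p form"

primrec dual :: "'p form \<Rightarrow> 'p form" where
  "dual (Pos p) = Neg p"
| "dual (Neg p) = Pos p"
| "dual (Or \<psi> \<chi>) = And (dual \<psi>) (dual \<chi>)"
| "dual (And \<psi> \<chi>) = Or (dual \<psi>) (dual \<chi>)"
| "dual (Dia \<psi>) = Box (dual \<psi>)"
| "dual (Box \<psi>) = Dia (dual \<psi>)"

primrec subforms :: "'p form \<Rightarrow> 'p form set" where
  "subforms (Pos p) = {Pos p}"
| "subforms (Neg p) = {Neg p}"
| "subforms (Or \<psi> \<chi>) = {Or \<psi> \<chi>} \<union> subforms \<psi> \<union> subforms \<chi>"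
| "subforms (And \<psi> \<chi>) = {And \<psi> \<chi>} \<union> subforms \<psi> \<union> subforms \<chi>"
| "subforms (Dia \<psi>) = {Dia \<psi>} \<union> subforms \<psi>"
| "subforms (Box \<psi>) = {Box \<psi>} \<union> subforms \<psi>"

record ('w, 'p) kripke =
  worlds :: "'w set"
  acc :: "('w \<times> 'w) set"
  val :: "'p \<Rightarrow> 'w set"

definition kripke_model :: "('w, 'p) kripke \<Rightarrow> bool" where
  "kripke_model M \<longleftrightarrow>
     worlds M \<noteq> {} \<and> acc M \<subseteq> worlds M \<times> worlds M \<and> (\<forall>p. val M p \<subseteq> worlds M)"

primrec sat :: "('w, 'p) kripke \<Rightarrow> 'w \<Rightarrow> 'p form \<Rightarrow> bool" where
  "sat M w (Pos p) \<longleftrightarrow> w \<in> val M p"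
| "sat M w (Neg p) \<longleftrightarrow> w \<notin> val M p"
| "sat M w (Or \<psi> \<chi>) \<longleftrightarrow> sat M w \<psi> \<or> sat M w \<chi>"
| "sat M w (And \<psi> \<chi>) \<longleftrightarrow> sat M w \<psi> \<and> sat M w \<chi>"
| "sat M w (Dia \<psi>) \<longleftrightarrow> (\<exists>v. (w, v) \<in> acc M \<and> sat M v \<psi>)"
| "sat M w (Box \<psi>) \<longleftrightarrow> (\<forall>v. (w, v) \<in> acc M \<longrightarrow> sat M v \<psi>)"

text \<open>The pair \<open>(k, n)\<close> stands for the quasi-density property
  \<open>\<forall>x y. R\<^sup>k(x,y) \<longrightarrow> R\<^sup>n(x,y)\<close>.\<close>

type_synonym qdp = "nat \<times> nat"

definition is_qdp :: "qdp \<Rightarrow> bool" where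
  "is_qdp = (\<lambda>(k, n). 0 < k \<and> k < n)"

definition satisfies_qdp :: "('w \<times> 'w) set \<Rightarrow> qdp \<Rightarrow> bool" where
  "satisfies_qdp r = (\<lambda>(k, n). \<forall>x y. (x, y) \<in> r ^^ k \<longrightarrow> (x, y) \<in> r ^^ n)"

text \<open>HOL cannot quantify over all types inside a definition, so validity is relative to a
  type \<open>'w\<close> of which the worlds are elements.\<close>

definition qdp_valid :: "'w itself \<Rightarrow> qdp set \<Rightarrow> 'p form \<Rightarrow> bool" where
  "qdp_valid (_ :: 'w itself) \<P> \<psi> \<longleftrightarrow>
     (\<forall>M :: ('w, 'p) kripke. kripke_model M \<and> (\<forall>q\<in>\<P>. satisfies_qdp (acc M) q) \<longrightarrow>
        (\<forall>w\<in>worlds M. sat M w \<psi>))"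


subsection \<open>Terms, instances, homomorphisms\<close>

datatype symbol = Const nat | Var nat

type_synonym trm = "symbol list"

abbreviation const :: "nat \<Rightarrow> trm" where "const c \<equiv> [Const c]"
abbreviation var :: "nat \<Rightarrow> trm" where "var i \<equiv> [Var i]"

datatype (dead 'p, atom_terms: 't) atom =
    PAtom "'p form" 't
  | RAtom 't 't
  | EAtom 't 't
  | Contr
  for map: map_atom

type_synonym 'p atoms = "('p, trm) atom set"

definition terms :: "'p atoms \<Rightarrow> trm set" where
  "terms I = (\<Union>\<alpha>\<in>I. atom_terms \<alpha>)"

definition homomorphism :: "(trm \<Rightarrow> trm) \<Rightarrow> 'p atoms \<Rightarrow> 'p atoms \<Rightarrow> bool" where
  "homomorphism h A B \<longleftrightarrow> (\<forall>c. h (const c) = const c) \<and> map_atom h ` A \<subseteq> B"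


subsection \<open>The disjunctive chase\<close>

text \<open>The head is the set of its disjuncts.  A disjunct is given by its atoms; its existentially
  quantified variables are those that do not occur in the body.\<close>

datatype 'p rule = Rule (body: "'p atoms") (head: "'p atoms set")

definition exvars :: "'p rule \<Rightarrow> 'p atoms \<Rightarrow> trm set" where
  "exvars \<rho> \<gamma> = (terms \<gamma> \<inter> range var) - terms (body \<rho>)"

definition trigger :: "'p atoms \<Rightarrow> 'p rule \<Rightarrow> (trm \<Rightarrow> trm) \<Rightarrow> bool" where
  "trigger I \<rho> h \<longleftrightarrow> homomorphism h (body \<rho>) I"

text \<open>Only the values of \<open>h\<close> on the terms of the body are part of a trigger; hence ``extends''
  means agreement on these terms.\<close>

definition active_trigger :: "'p atoms \<Rightarrow> 'p rule \<Rightarrow> (trm \<Rightarrow> trm) \<Rightarrow> bool" where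
  "active_trigger I \<rho> h \<longleftrightarrow> trigger I \<rho> h \<and>
     \<not> (\<exists>\<gamma>\<in>head \<rho>. \<exists>h'. (\<forall>t\<in>terms (body \<rho>). h' t = h t) \<and> homomorphism h' (body \<rho> \<union> \<gamma>) I)"

text \<open>The function \<open>f\<close> supplies pairwise distinct fresh terms for the existential variables.
  All admissible choices of fresh terms are included.\<close>

definition application ::
    "'p atoms \<Rightarrow> 'p rule \<Rightarrow> (trm \<Rightarrow> trm) \<Rightarrow> 'p atoms set" where
  "application I \<rho> h =
     {I \<union> map_atom (\<lambda>t. if t \<in> exvars \<rho> \<gamma> then f t else h t) ` \<gamma> | \<gamma> f.
        \<gamma> \<in> head \<rho> \<and> inj_on f (exvars \<rho> \<gamma>) \<and> f ` exvars \<rho> \<gamma> \<inter> terms I = {}}"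

text \<open>Derivations may be finite or infinite: the sequence is \<open>(S i)\<close> for \<open>i \<le> N\<close>, where
  \<open>N = \<infinity>\<close> is allowed.  By fairness, a finite one ends in an instance without active triggers.\<close>

definition fair_derivation ::
    "'p atoms \<Rightarrow> 'p rule set \<Rightarrow> enat \<Rightarrow> (nat \<Rightarrow> 'p atoms) \<Rightarrow> bool" where
  "fair_derivation I \<R> N S \<longleftrightarrow>
     S 0 = I \<and>
     (\<forall>i. enat (Suc i) \<le> N \<longrightarrow>
        (\<exists>\<rho>\<in>\<R>. \<exists>h. active_trigger (S i) \<rho> h \<and> S (Suc i) \<in> application (S i) \<rho> h)) \<and>
     (\<forall>i. enat i \<le> N \<longrightarrow>
        (\<forall>\<rho>\<in>\<R>. \<forall>h. active_trigger (S i) \<rho> h \<longrightarrow>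
           (\<exists>j>i. enat j \<le> N \<and> \<not> active_trigger (S j) \<rho> h)))"

definition Ch :: "'p atoms \<Rightarrow> 'p rule set \<Rightarrow> 'p atoms set" where
  "Ch I \<R> = {(\<Union>i\<in>{i. enat i \<le> N}. S i) | N S. fair_derivation I \<R> N S}"


subsection \<open>The database and the rules\<close>

definition database :: "nat \<Rightarrow> 'p form \<Rightarrow> 'p atoms" where
  "database a \<phi> = {PAtom \<phi> (const a)}"

definition path_atoms :: "trm list \<Rightarrow> 'p atoms" where
  "path_atoms ts = {RAtom (ts ! i) (ts ! Suc i) | i. Suc i < length ts}"

text \<open>Here \<open>x = var 0\<close>, \<open>y\<^sub>i = var i\<close>, \<open>y = var k\<close> and \<open>z\<^sub>i = var (k + i)\<close>.\<close>

definition qdp_rule :: "qdp \<Rightarrow> 'p rule" where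
  "qdp_rule = (\<lambda>(k, n).
     Rule (path_atoms (map var [0..<k + 1]))
          {path_atoms (var 0 # map var [k + 1..<k + n] @ [var k])})"

definition formula_rules :: "'p form \<Rightarrow> 'p rule set" where
  "formula_rules \<phi> =
     {Rule {PAtom (And \<psi> \<chi>) (var 0)} {{PAtom \<psi> (var 0), PAtom \<chi> (var 0)}} | \<psi> \<chi>.
        And \<psi> \<chi> \<in> subforms \<phi>} \<union>
     {Rule {PAtom (Or \<psi> \<chi>) (var 0)} {{PAtom \<psi> (var 0)}, {PAtom \<chi> (var 0)}} | \<psi> \<chi>.
        Or \<psi> \<chi> \<in> subforms \<phi>} \<union>
     {Rule {PAtom (Box \<psi>) (var 0), RAtom (var 0) (var 1)} {{PAtom \<psi> (var 1)}} | \<psi>.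
        Box \<psi> \<in> subforms \<phi>} \<union>
     {Rule {PAtom (Dia \<psi>) (var 0)}
           {{RAtom (var 0) (var 1), EAtom (var 0) (var 1), PAtom \<psi> (var 1)}} | \<psi>.
        Dia \<psi> \<in> subforms \<phi>} \<union>
     {Rule {PAtom \<psi> (var 0), PAtom (dual \<psi>) (var 0)} {{Contr}} | \<psi>.
        \<psi> \<in> subforms \<phi> \<and> dual \<psi> \<in> subforms \<phi>}"

end

theory Submission
  imports Defs "HOL-Library.Countable_Set"
begin

text \<open>If \<open>dual \<phi>\<close> fails at a world \<open>w\<close> of a \<open>\<P>\<close>-model \<open>M\<close>, then \<open>\<phi>\<close> holds at \<open>w\<close>, and the
  chase can be run so that every instance is mapped into \<open>M\<close>: the model tells which disjunct to
  choose and where to send the fresh terms. An instance that maps into \<open>M\<close> cannot contain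
  \<open>Contr\<close>. Fairness is achieved by always applying an active trigger with the least code in a
  fixed enumeration of the triggers: an applied trigger is never active again, so only finitely
  many steps can precede a given trigger.\<close>

section \<open>Triggers\<close>

text \<open>Trigger codes record only the values on the terms of the body, so these values must
  determine activity. Constants are assumed fixed separately because \<open>homomorphism\<close>
  also constrains constants outside the body.\<close>

lemma active_trigger_cong:
  assumes "\<forall>t\<in>terms (body \<rho>). h t = h' t" and "\<forall>c. h' (const c) = const c"
    and "active_trigger I \<rho> h"
  shows "active_trigger I \<rho> h'"
proof -
  have "map_atom h \<alpha> = map_atom h' \<alpha>" if "\<alpha> \<in> body \<rho>" for \<alpha>
    using that assms(1) by (intro atom.map_cong0) (auto simp: terms_def)
  then have "map_atom h ` body \<rho> = map_atom h' ` body \<rho>"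
    by simp
  with assms show ?thesis
    by (simp add: active_trigger_def trigger_def homomorphism_def)
qed

text \<open>An extension into \<open>I\<close> is also one into \<open>J\<close>. Assuming a trigger
  in \<open>I\<close> excludes inactivity for lack of a body match, which could appear
  later.\<close>

lemma inactive_trigger_mono:
  assumes "trigger I \<rho> h" "\<not> active_trigger I \<rho> h" "I \<subseteq> J"
  shows "\<not> active_trigger J \<rho> h"
  using assms unfolding active_trigger_def homomorphism_def by (meson subset_trans)

lemma application_increasing: "J \<in> application I \<rho> h \<Longrightarrow> I \<subseteq> J"
  by (auto simp: application_def)

lemma trigger_mono: "trigger I \<rho> h \<Longrightarrow> I \<subseteq> J \<Longrightarrow> trigger J \<rho> h"
  by (auto simp: trigger_def homomorphism_def)

text \<open>The map that produces the new atoms is itself the extension that blocks activity: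
  existential variables lie outside the body, so it agrees with \<open>h\<close> there, and they are
  not constants.\<close>

lemma application_inactive:
  assumes "trigger I \<rho> h" "J \<in> application I \<rho> h"
  shows "\<not> active_trigger J \<rho> h"
proof -
  from assms(2) obtain \<gamma> f where \<gamma>: "\<gamma> \<in> head \<rho>"
    and J: "J = I \<union> map_atom (\<lambda>t. if t \<in> exvars \<rho> \<gamma> then f t else h t) ` \<gamma>"
    unfolding application_def by blast
  let ?h = "\<lambda>t. if t \<in> exvars \<rho> \<gamma> then f t else h t"
  have agree: "\<forall>t\<in>terms (body \<rho>). ?h t = h t"
    by (auto simp: exvars_def)
  have "map_atom ?h \<alpha> = map_atom h \<alpha>" if "\<alpha> \<in> body \<rho>" for \<alpha>
    using that agree by (intro atom.map_cong0) (auto simp: terms_def)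
  then have "map_atom ?h ` body \<rho> = map_atom h ` body \<rho>"
    by simp
  moreover have "const c \<notin> exvars \<rho> \<gamma>" for c
    by (auto simp: exvars_def)
  ultimately have "homomorphism ?h (body \<rho> \<union> \<gamma>) J"
    using assms(1) by (auto simp: homomorphism_def trigger_def J image_Un)
  with agree have "\<exists>h'. (\<forall>t\<in>terms (body \<rho>). h' t = h t) \<and> homomorphism h' (body \<rho> \<union> \<gamma>) J"
    by (intro exI[of _ ?h]) blast
  with \<gamma> show ?thesis
    unfolding active_trigger_def by blast
qed

section \<open>Existence of fair derivations\<close>

instance symbol :: countable
  by countable_datatype

text \<open>There are uncountably many maps \<open>h\<close>, but only their values on the finitely
  many terms of the body matter. The index of the rule and the list of these values live in a
  countable type.\<close>

lemma ex_trigger_code: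
  assumes "countable \<R>" and "\<And>\<rho>. \<rho> \<in> \<R> \<Longrightarrow> finite (terms (body \<rho>))"
  shows "\<exists>code :: 'p rule \<Rightarrow> (trm \<Rightarrow> trm) \<Rightarrow> nat. \<forall>\<rho>\<in>\<R>. \<forall>\<rho>'\<in>\<R>. \<forall>h h'.
           code \<rho> h = code \<rho>' h' \<longrightarrow> \<rho> = \<rho>' \<and> (\<forall>t\<in>terms (body \<rho>). h t = h' t)"
proof -
  have "\<forall>\<rho>\<in>\<R>. \<exists>l. set l = terms (body \<rho>)"
    using assms(2) finite_list by blast
  then obtain l where l: "\<And>\<rho>. \<rho> \<in> \<R> \<Longrightarrow> set (l \<rho>) = terms (body \<rho>)"
    by metis
  show ?thesis
  proof (intro exI ballI allI impI)
    fix \<rho> \<rho>' and h h' :: "trm \<Rightarrow> trm"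
    assume R: "\<rho> \<in> \<R>" "\<rho>' \<in> \<R>"
      and eq: "to_nat (to_nat_on \<R> \<rho>, map h (l \<rho>)) = to_nat (to_nat_on \<R> \<rho>', map h' (l \<rho>'))"
    from eq have "to_nat_on \<R> \<rho> = to_nat_on \<R> \<rho>'" and m: "map h (l \<rho>) = map h' (l \<rho>')"
      by simp_all
    with R assms(1) have "\<rho> = \<rho>'"
      by simp
    with m l R show "\<rho> = \<rho>' \<and> (\<forall>t\<in>terms (body \<rho>). h t = h' t)"
      by (metis map_eq_conv)
  qed
qed

text \<open>Only some result of each application has to preserve \<open>Inv\<close>: the invariant
  selects the disjunct and the fresh terms, while the scheduling selects the trigger.\<close>

lemma ex_fair_derivation:
  fixes \<R> :: "'p rule set"
  assumes cnt: "countable \<R>" and fin: "\<And>\<rho>. \<rho> \<in> \<R> \<Longrightarrow> finite (terms (body \<rho>))"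
    and init: "Inv I"
    and step: "\<And>J \<rho> h. Inv J \<Longrightarrow> \<rho> \<in> \<R> \<Longrightarrow> active_trigger J \<rho> h \<Longrightarrow>
                 \<exists>J'\<in>application J \<rho> h. Inv J'"
  shows "\<exists>N S. fair_derivation I \<R> N S \<and> (\<forall>i. Inv (S i))"
proof -
  obtain code :: "'p rule \<Rightarrow> (trm \<Rightarrow> trm) \<Rightarrow> nat" where
    code: "\<And>\<rho> \<rho>' h h'. \<rho> \<in> \<R> \<Longrightarrow> \<rho>' \<in> \<R> \<Longrightarrow> code \<rho> h = code \<rho>' h' \<Longrightarrow>
             \<rho> = \<rho>' \<and> (\<forall>t\<in>terms (body \<rho>). h t = h' t)"
    using ex_trigger_code[OF cnt fin] by metis
  define live where "live J \<longleftrightarrow> (\<exists>\<rho>\<in>\<R>. \<exists>h. active_trigger J \<rho> h)" for J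
  define good where "good J J' \<rho> h \<longleftrightarrow> \<rho> \<in> \<R> \<and> active_trigger J \<rho> h \<and> J' \<in> application J \<rho> h \<and>
      (\<forall>\<rho>'\<in>\<R>. \<forall>h'. active_trigger J \<rho>' h' \<longrightarrow> code \<rho> h \<le> code \<rho>' h')" for J J' \<rho> h
  \<comment> \<open>Repeating an instance without active triggers makes the successor total; the
    constant tail is cut off below.\<close>
  have "\<exists>J'. Inv J' \<and> (if live J then \<exists>\<rho> h. good J J' \<rho> h else J' = J)" if "Inv J" for J
  proof (cases "live J")
    case True
    define Q where "Q = (\<lambda>(\<rho>, h). \<rho> \<in> \<R> \<and> active_trigger J \<rho> h)"
    from True obtain p where "Q p"
      unfolding live_def Q_def by auto
    then obtain q where q: "Q q" "\<And>p. Q p \<Longrightarrow> case_prod code q \<le> case_prod code p"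
      using ex_has_least_nat[of Q p "case_prod code"] by blast
    obtain \<rho> h where [simp]: "q = (\<rho>, h)" by force
    have act: "\<rho> \<in> \<R>" "active_trigger J \<rho> h"
      using q(1) by (simp_all add: Q_def)
    then obtain J' where "J' \<in> application J \<rho> h" "Inv J'"
      using step \<open>Inv J\<close> by blast
    moreover have "code \<rho> h \<le> code \<rho>' h'" if "\<rho>' \<in> \<R>" "active_trigger J \<rho>' h'" for \<rho>' h'
      using q(2)[of "(\<rho>', h')"] that by (simp add: Q_def)
    ultimately have "good J J' \<rho> h" "Inv J'"
      using act unfolding good_def by blast+
    with True show ?thesis
      by auto
  qed (use that in auto)
  then obtain nxt where nxt:
    "\<And>J. Inv J \<Longrightarrow> Inv (nxt J) \<and> (if live J then \<exists>\<rho> h. good J (nxt J) \<rho> h else nxt J = J)"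
    by metis
  define S where "S i = (nxt ^^ i) I" for i
  have S_Suc: "S (Suc i) = nxt (S i)" for i
    by (simp add: S_def)
  have inv: "Inv (S i)" for i
    by (induction i) (use init nxt in \<open>auto simp: S_def\<close>)
  have live_step: "\<exists>\<rho> h. good (S i) (S (Suc i)) \<rho> h" if "live (S i)" for i
    using nxt[OF inv[of i]] that by (simp add: S_Suc)
  have "S i \<subseteq> S (Suc i)" for i
  proof (cases "live (S i)")
    case True
    then show ?thesis
      using live_step unfolding good_def by (meson application_increasing)
  next
    case False
    then show ?thesis
      using nxt[OF inv[of i]] by (simp add: S_Suc)
  qed
  then have mono: "S i \<subseteq> S j" if "i \<le> j" for i j
    using that by (rule lift_Suc_mono_le)
  show ?thesis
  proof (cases "\<exists>n. \<not> live (S n)")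
    case True
    \<comment> \<open>A finite derivation ends at the first instance without active triggers, and
      \<open>n\<close> itself witnesses fairness for every earlier index.\<close>
    define n where "n = (LEAST n. \<not> live (S n))"
    have stop: "\<not> live (S n)"
      unfolding n_def using True by (rule LeastI_ex)
    have before: "live (S i)" if "i < n" for i
      using not_less_Least that unfolding n_def by blast
    have "\<exists>j>i. enat j \<le> enat n \<and> \<not> active_trigger (S j) \<rho> h"
      if "enat i \<le> enat n" "\<rho> \<in> \<R>" "active_trigger (S i) \<rho> h" for i \<rho> h
      using that stop unfolding live_def
      by (intro exI[of _ n]) (auto simp: order_less_le)
    moreover have "\<exists>\<rho>\<in>\<R>. \<exists>h. active_trigger (S i) \<rho> h \<and> S (Suc i) \<in> application (S i) \<rho> h"
      if "enat (Suc i) \<le> enat n" for i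
      using live_step[OF before[of i]] that unfolding good_def by auto
    moreover have "S 0 = I"
      by (simp add: S_def)
    ultimately have "fair_derivation I \<R> (enat n) S"
      unfolding fair_derivation_def by blast
    with inv show ?thesis by blast
  next
    case False
    then have "\<forall>i. \<exists>\<rho> h. good (S i) (S (Suc i)) \<rho> h"
      using live_step by blast
    then obtain r g where rg: "\<And>i. good (S i) (S (Suc i)) (r i) (g i)"
      by metis
    \<comment> \<open>An application deactivates its trigger, and this persists because instances
      only grow.\<close>
    have dead: "\<not> active_trigger (S j) (r i) (g i)" if "i < j" for i j
    proof -
      have t: "trigger (S i) (r i) (g i)" and a: "S (Suc i) \<in> application (S i) (r i) (g i)"
        using rg[of i] by (simp_all add: good_def active_trigger_def)
      show ?thesis
      proof (rule inactive_trigger_mono)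
        show "trigger (S (Suc i)) (r i) (g i)"
          using t mono by (rule trigger_mono) simp
        show "\<not> active_trigger (S (Suc i)) (r i) (g i)"
          using application_inactive t a by blast
        show "S (Suc i) \<subseteq> S j"
          using that by (intro mono) simp
      qed
    qed
    \<comment> \<open>With equal codes, the trigger applied at \<open>i\<close> would be active
      again at \<open>j\<close>, although it is dead by then.\<close>
    have inj: "code (r i) (g i) \<noteq> code (r j) (g j)" if "i < j" for i j
    proof
      assume "code (r i) (g i) = code (r j) (g j)"
      then have eq: "r i = r j" "\<forall>t\<in>terms (body (r j)). g j t = g i t"
        using code[of "r i" "r j" "g i" "g j"] rg[of i] rg[of j] by (auto simp: good_def)
      have "\<forall>c. g i (const c) = const c"
        using rg[of i] by (simp add: good_def active_trigger_def trigger_def homomorphism_def)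
      moreover have "active_trigger (S j) (r j) (g j)"
        using rg[of j] by (simp add: good_def)
      ultimately have "active_trigger (S j) (r j) (g i)"
        using active_trigger_cong[OF eq(2)] by blast
      with dead[OF that] eq(1) show False by simp
    qed
    \<comment> \<open>As long as a trigger stays active, every applied code is at most its code;
      since applied codes are distinct, this cannot last for infinitely many steps.\<close>
    have "\<exists>j>i. \<not> active_trigger (S j) \<rho> h" if "\<rho> \<in> \<R>" for i \<rho> h
    proof (rule ccontr)
      assume "\<not> ?thesis"
      then have "code (r j) (g j) \<le> code \<rho> h" if "j > i" for j
        using rg[of j] that \<open>\<rho> \<in> \<R>\<close> unfolding good_def by blast
      then have "(\<lambda>j. code (r j) (g j)) ` {i<..} \<subseteq> {..code \<rho> h}"
        by auto
      moreover have "inj_on (\<lambda>j. code (r j) (g j)) {i<..}"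
        by (rule linorder_inj_onI) (use inj in auto)
      ultimately have "finite {i<..}"
        using finite_subset finite_imageD by blast
      then show False
        using infinite_Ioi by blast
    qed
    then have "fair_derivation I \<R> \<infinity> S"
      using rg unfolding fair_derivation_def good_def by (simp add: S_def) blast
    with inv show ?thesis by blast
  qed
qed

section \<open>Interpreting instances in a Kripke model\<close>

lemma sat_dual [simp]: "sat M w (dual \<psi>) \<longleftrightarrow> \<not> sat M w \<psi>"
  by (induction \<psi> arbitrary: w) auto

text \<open>Atoms are polymorphic in their terms, so \<open>map_atom\<close> turns an instance into
  claims about worlds. Since \<open>E\<close> is only ever derived together with \<open>R\<close>,
  the accessibility relation can serve for both.\<close>

primrec holds :: "('w, 'p) kripke \<Rightarrow> ('p, 'w) atom \<Rightarrow> bool" where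
  "holds M (PAtom \<psi> w) \<longleftrightarrow> sat M w \<psi>"
| "holds M (RAtom v w) \<longleftrightarrow> (v, w) \<in> acc M"
| "holds M (EAtom v w) \<longleftrightarrow> (v, w) \<in> acc M"
| "holds M Contr \<longleftrightarrow> False"

definition interprets :: "('w, 'p) kripke \<Rightarrow> (trm \<Rightarrow> 'w) \<Rightarrow> 'p atoms \<Rightarrow> bool" where
  "interprets M g I \<longleftrightarrow> (\<forall>\<alpha>\<in>I. holds M (map_atom g \<alpha>))"

text \<open>Truth of the rule in \<open>M\<close> as a first-order sentence, with assignments
  defined on all terms.\<close>

definition sound_rule :: "('w, 'p) kripke \<Rightarrow> 'p rule \<Rightarrow> bool" where
  "sound_rule M \<rho> \<longleftrightarrow> (\<forall>s. interprets M s (body \<rho>) \<longrightarrow>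
     (\<exists>\<gamma>\<in>head \<rho>. \<exists>s'. (\<forall>t. t \<notin> exvars \<rho> \<gamma> \<longrightarrow> s' t = s t) \<and> interprets M s' \<gamma>))"

lemma interprets_cong:
  assumes "\<And>t. t \<in> terms I \<Longrightarrow> g t = g' t"
  shows "interprets M g I \<longleftrightarrow> interprets M g' I"
proof -
  have "map_atom g \<alpha> = map_atom g' \<alpha>" if "\<alpha> \<in> I" for \<alpha>
    using that assms by (intro atom.map_cong0) (auto simp: terms_def)
  then show ?thesis
    by (simp add: interprets_def)
qed

lemma interprets_image: "interprets M g (map_atom h ` I) \<longleftrightarrow> interprets M (g \<circ> h) I"
  by (simp add: interprets_def atom.map_comp)

lemma terms_image: "terms (map_atom h ` I) = h ` terms I"
  by (auto simp: terms_def atom.set_map)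

lemma finite_atom_terms: "finite (atom_terms \<alpha>)"
  by (cases \<alpha>) auto

lemma finite_terms: "finite I \<Longrightarrow> finite (terms I)"
  by (simp add: terms_def finite_atom_terms)

lemma ex_interpreted_application:
  fixes I :: "'p atoms" and M :: "('w, 'p) kripke"
  assumes "finite I" "interprets M g I" "trigger I \<rho> h" "sound_rule M \<rho>"
    and head: "\<And>\<gamma>. \<gamma> \<in> head \<rho> \<Longrightarrow> finite \<gamma> \<and> terms \<gamma> \<subseteq> range var"
  shows "\<exists>J\<in>application I \<rho> h. finite J \<and> (\<exists>g'. interprets M g' J)"
proof -
  have hb: "map_atom h ` body \<rho> \<subseteq> I"
    using assms(3) by (simp add: trigger_def homomorphism_def)
  then have "interprets M (g \<circ> h) (body \<rho>)"
    using assms(2) by (subst interprets_image[symmetric]) (auto simp: interprets_def)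
  then obtain \<gamma> s where \<gamma>: "\<gamma> \<in> head \<rho>"
    and s: "\<And>t. t \<notin> exvars \<rho> \<gamma> \<Longrightarrow> s t = g (h t)" "interprets M s \<gamma>"
    using assms(4) unfolding sound_rule_def by force
  define X where "X = exvars \<rho> \<gamma>"
  have "finite X"
    using head[OF \<gamma>] finite_terms by (auto simp: X_def exvars_def)
  moreover have "infinite (- terms I)"
    using finite_terms[OF assms(1)] infinite_UNIV_listI by (metis finite_compl)
  then obtain B where B: "finite B" "card B = card X" "B \<subseteq> - terms I"
    using infinite_arbitrarily_large by blast
  ultimately obtain f where "bij_betw f X B"
    using finite_same_card_bij by metis
  with B have f: "inj_on f X" "f ` X \<subseteq> - terms I"
    by (auto simp: bij_betw_def)
  define h' where "h' = (\<lambda>t. if t \<in> X then f t else h t)"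
  \<comment> \<open>The inverse of \<open>f\<close> recovers the existential variable that a fresh
    term stands for.\<close>
  define g' where "g' = (\<lambda>t. if t \<in> f ` X then s (inv_into X f t) else g t)"
  have "g' (h' t) = s t" if "t \<in> terms \<gamma>" for t
  proof (cases "t \<in> X")
    case True
    then show ?thesis
      using f(1) by (simp add: g'_def h'_def)
  next
    case False
    \<comment> \<open>A variable of the disjunct that is not existential occurs in the body, so its
      image is an old term, on which \<open>g'\<close> equals \<open>g\<close>.\<close>
    then have "t \<in> terms (body \<rho>)"
      using that head[OF \<gamma>] by (auto simp: X_def exvars_def)
    then have "h t \<in> terms (map_atom h ` body \<rho>)"
      by (simp add: terms_image)
    then have "h t \<in> terms I"
      using hb by (auto simp: terms_def)
    then show ?thesis
      using f(2) False s(1) by (auto simp: g'_def h'_def X_def)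
  qed
  then have "interprets M g' (map_atom h' ` \<gamma>)"
    using s(2) interprets_cong[of \<gamma> "g' \<circ> h'" s] by (simp add: interprets_image)
  moreover have "interprets M g' I"
    using assms(2) f(2) interprets_cong[of I g' g M] by (fastforce simp: g'_def)
  ultimately have "interprets M g' (I \<union> map_atom h' ` \<gamma>)"
    by (auto simp: interprets_def)
  moreover have "I \<union> map_atom h' ` \<gamma> \<in> application I \<rho> h"
    using \<gamma> f unfolding application_def h'_def X_def by blast
  moreover have "finite (I \<union> map_atom h' ` \<gamma>)"
    using assms(1) head[OF \<gamma>] by simp
  ultimately show ?thesis
    by blast
qed

section \<open>Soundness of the rules\<close>

lemma finite_subforms: "finite (subforms \<phi>)"
  by (induction \<phi>) auto

text \<open>Constructors are injective, so only finitely many arguments yield a subformula of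
  \<open>\<phi>\<close>; the local facts treat constructors with two arguments and with one.\<close>

lemma finite_formula_rules: "finite (formula_rules \<phi>)"
proof -
  have 2: "finite {f \<psi> \<chi> | \<psi> \<chi>. c \<psi> \<chi> \<in> subforms \<phi>}"
    if "\<And>a b a' b'. c a b = c a' b' \<Longrightarrow> a = a' \<and> b = b'"
    for f :: "'a form \<Rightarrow> 'a form \<Rightarrow> 'a rule" and c
  proof -
    have "{f \<psi> \<chi> | \<psi> \<chi>. c \<psi> \<chi> \<in> subforms \<phi>} = case_prod f ` (case_prod c -` subforms \<phi>)"
      by force
    moreover have "inj (case_prod c)"
      by (auto intro!: injI dest: that)
    ultimately show ?thesis
      by (simp add: finite_vimageI finite_subforms)
  qed
  have 1: "finite {f \<psi> | \<psi>. c \<psi> \<in> subforms \<phi>}" if "inj c"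
    for f :: "'a form \<Rightarrow> 'a rule" and c
  proof -
    have "{f \<psi> | \<psi>. c \<psi> \<in> subforms \<phi>} = f ` (c -` subforms \<phi>)"
      by force
    with that show ?thesis
      by (simp add: finite_vimageI finite_subforms)
  qed
  show ?thesis
    unfolding formula_rules_def
    by (intro finite_UnI 1 2) (auto simp: inj_def finite_subforms)
qed

lemma formula_rules_finite_terms:
  assumes "\<rho> \<in> formula_rules \<phi>"
  shows "finite (body \<rho>)" and "\<gamma> \<in> head \<rho> \<Longrightarrow> finite \<gamma> \<and> terms \<gamma> \<subseteq> range var"
  using assms by (auto simp: formula_rules_def terms_def)

text \<open>Only the diamond rule needs a new world, taken from the semantics of \<open>Dia\<close>.
  In the other cases the assignment is kept; the body of a \<open>Contr\<close> rule is never
  satisfied, by \<open>sat_dual\<close>.\<close>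

lemma formula_rules_sound:
  assumes "\<rho> \<in> formula_rules \<phi>"
  shows "sound_rule M \<rho>"
proof -
  have dia: "sound_rule M (Rule {PAtom (Dia \<psi>) (var 0)}
      {{RAtom (var 0) (var 1), EAtom (var 0) (var 1), PAtom \<psi> (var 1)}})" (is "sound_rule M ?\<rho>")
    for \<psi>
    unfolding sound_rule_def
  proof (intro allI impI)
    fix s assume "interprets M s (body ?\<rho>)"
    then obtain v where "(s (var 0), v) \<in> acc M" "sat M v \<psi>"
      by (auto simp: interprets_def)
    then show "\<exists>\<gamma>\<in>head ?\<rho>. \<exists>s'. (\<forall>t. t \<notin> exvars ?\<rho> \<gamma> \<longrightarrow> s' t = s t) \<and> interprets M s' \<gamma>"
      by (auto simp: interprets_def exvars_def terms_def intro!: exI[of _ "s(var 1 := v)"])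
  qed
  show ?thesis
  proof (cases "\<exists>\<psi>. \<rho> = Rule {PAtom (Dia \<psi>) (var 0)}
      {{RAtom (var 0) (var 1), EAtom (var 0) (var 1), PAtom \<psi> (var 1)}}")
    case True
    with dia show ?thesis by blast
  next
    case False
    then have "\<exists>\<gamma>\<in>head \<rho>. interprets M s \<gamma>" if "interprets M s (body \<rho>)" for s
      using assms that unfolding formula_rules_def by (auto simp: interprets_def)
    then show ?thesis
      unfolding sound_rule_def by blast
  qed
qed

section \<open>Paths and quasi-density rules\<close>

lemma finite_path_atoms: "finite (path_atoms ts :: 'p atoms)"
proof -
  have "(path_atoms ts :: 'p atoms) = (\<lambda>i. RAtom (ts ! i) (ts ! Suc i)) ` {i. Suc i < length ts}"
    by (auto simp: path_atoms_def)
  moreover have "finite {i. Suc i < length ts}"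
    by (rule finite_subset[of _ "{..<length ts}"]) auto
  ultimately show ?thesis
    by simp
qed

lemma terms_path_atoms: "terms (path_atoms ts) \<subseteq> set ts"
  by (fastforce simp: terms_def path_atoms_def)

text \<open>A one-element list has no edges, hence the length bound. The last entry occurs only as
  the target of an edge, hence the case split.\<close>

lemma nth_mem_terms_path_atoms:
  assumes "i < length ts" "2 \<le> length ts"
  shows "ts ! i \<in> terms (path_atoms ts)"
proof (cases "Suc i < length ts")
  case True
  then have "RAtom (ts ! i) (ts ! Suc i) \<in> path_atoms ts"
    by (auto simp: path_atoms_def)
  then show ?thesis
    by (force simp: terms_def)
next
  case False
  with assms obtain j where j: "i = Suc j"
    by (cases i) auto
  then have "RAtom (ts ! j) (ts ! i) \<in> path_atoms ts"
    using assms(1) by (auto simp: path_atoms_def)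
  then show ?thesis
    by (force simp: terms_def)
qed

lemma interprets_path_atoms:
  "interprets M s (path_atoms ts) \<longleftrightarrow>
     (\<forall>i. Suc i < length ts \<longrightarrow> (s (ts ! i), s (ts ! Suc i)) \<in> acc M)"
  by (auto simp: interprets_def path_atoms_def)

lemma qdp_rule_finite_terms:
  shows "finite (body (qdp_rule q))"
    and "\<gamma> \<in> head (qdp_rule q) \<Longrightarrow> finite \<gamma> \<and> terms \<gamma> \<subseteq> range var"
  using terms_path_atoms
  by (force simp: qdp_rule_def finite_path_atoms split: prod.splits)+

text \<open>The interpreted body is an accessibility path of length \<open>k\<close>. The property
  gives one of length \<open>n\<close> between the same worlds, and its inner points are the values
  of the existential variables.\<close>

lemma qdp_rule_sound:
  assumes "is_qdp q" "satisfies_qdp (acc M) q"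
  shows "sound_rule M (qdp_rule q :: 'p rule)"
proof -
  obtain k n where q: "q = (k, n)" by force
  have kn: "0 < k" "k < n"
    using assms(1) by (auto simp: is_qdp_def q)
  define ts where "ts = var 0 # map var [k + 1..<k + n] @ [var k]"
  have len: "length ts = Suc n"
    using kn by (simp add: ts_def)
  have nth: "ts ! i = (if i = 0 then var 0 else if i < n then var (k + i) else var k)"
    if "i \<le> n" for i
    using that kn by (cases i) (auto simp: ts_def nth_append)
  define \<rho> :: "'p rule" where
    "\<rho> = Rule (path_atoms (map var [0..<k + 1])) {path_atoms ts}"
  have \<rho>: "qdp_rule q = \<rho>"
    by (simp add: qdp_rule_def q \<rho>_def ts_def)
  \<comment> \<open>The inner entries of \<open>ts\<close> have indices above \<open>k\<close>,
    whereas the body uses only the indices from \<open>0\<close> to \<open>k\<close>.\<close>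
  have ex: "var (k + i) \<in> exvars \<rho> (path_atoms ts)" if "0 < i" "i < n" for i
  proof -
    have "var (k + i) \<in> terms (path_atoms ts :: 'p atoms)"
      using nth_mem_terms_path_atoms[of i ts] that len nth[of i] by auto
    moreover have "var (k + i) \<notin> terms (path_atoms (map var [0..<k + 1]) :: 'p atoms)"
      using terms_path_atoms[of "map var [0..<k + 1]", where 'a = 'p] that by auto
    ultimately show ?thesis
      by (auto simp: exvars_def \<rho>_def)
  qed
  have "\<exists>s'. (\<forall>t. t \<notin> exvars \<rho> (path_atoms ts) \<longrightarrow> s' t = s t) \<and> interprets M s' (path_atoms ts)"
    if s: "interprets M s (body \<rho>)" for s
  proof -
    have "\<forall>i<k. (s (var i), s (var (Suc i))) \<in> acc M"
      using s by (simp add: \<rho>_def interprets_path_atoms del: upt_Suc)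
    then have "(s (var 0), s (var k)) \<in> acc M ^^ k"
      unfolding relpow_fun_conv by (intro exI[of _ "\<lambda>i. s (var i)"]) simp
    then have "(s (var 0), s (var k)) \<in> acc M ^^ n"
      using assms(2) by (auto simp: satisfies_qdp_def q)
    then obtain f where f: "f 0 = s (var 0)" "f n = s (var k)"
        "\<And>i. i < n \<Longrightarrow> (f i, f (Suc i)) \<in> acc M"
      unfolding relpow_fun_conv by blast
    \<comment> \<open>The definite description recovers the position on the path \<open>f\<close>.
      The bound \<open>0 < i\<close> leaves \<open>var k\<close> out, so both endpoints keep their
      values under \<open>s\<close>.\<close>
    define s' where "s' = (\<lambda>t. if \<exists>i. 0 < i \<and> i < n \<and> t = var (k + i)
        then f (THE i. t = var (k + i)) else s t)"
    have "s' (ts ! i) = f i" if "i \<le> n" for i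
      using that f kn by (auto simp: nth s'_def)
    then have "interprets M s' (path_atoms ts)"
      using f(3) by (simp add: interprets_path_atoms len)
    moreover have "\<forall>t. t \<notin> exvars \<rho> (path_atoms ts) \<longrightarrow> s' t = s t"
      using ex by (auto simp: s'_def)
    ultimately show ?thesis
      by blast
  qed
  then show ?thesis
    unfolding \<rho> sound_rule_def by (simp add: \<rho>_def)
qed

theorem theorem3p4:
  fixes \<P> :: "qdp set" and \<phi> :: "'p form" and a :: nat
  assumes "finite \<P>" and "\<forall>q\<in>\<P>. is_qdp q"
    and "\<forall>C \<in> Ch (database a \<phi>) (formula_rules \<phi> \<union> qdp_rule ` \<P>). Contr \<in> C"
  shows "qdp_valid TYPE('w) \<P> (dual \<phi>)"
  unfolding qdp_valid_def
proof (intro allI impI ballI)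
  fix M :: "('w, 'p) kripke" and w
  assume M: "kripke_model M \<and> (\<forall>q\<in>\<P>. satisfies_qdp (acc M) q)"
  let ?R = "formula_rules \<phi> \<union> qdp_rule ` \<P>"
  \<comment> \<open>Finiteness keeps fresh terms available; \<open>g\<close> is existential because
    it changes whenever fresh terms are added.\<close>
  let ?Inv = "\<lambda>I :: 'p atoms. finite I \<and> (\<exists>g. interprets M g I)"
  show "sat M w (dual \<phi>)"
  proof (rule ccontr)
    assume "\<not> sat M w (dual \<phi>)"
    \<comment> \<open>By \<open>sat_dual\<close>, \<open>\<phi>\<close> is true at \<open>w\<close>,
      so the constant assignment interprets the single atom of the database.\<close>
    then have "interprets M (\<lambda>_. w) (database a \<phi>)"
      by (simp add: interprets_def database_def)
    then have init: "?Inv (database a \<phi>)"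
      by (auto simp: database_def)
    have "\<exists>N S. fair_derivation (database a \<phi>) ?R N S \<and> (\<forall>i. ?Inv (S i))"
    proof (rule ex_fair_derivation)
      show "countable ?R"
        using assms(1) finite_formula_rules by (intro countable_finite) simp
      show "finite (terms (body \<rho>))" if "\<rho> \<in> ?R" for \<rho>
        using that formula_rules_finite_terms(1) qdp_rule_finite_terms(1)
        by (intro finite_terms) blast
      show "?Inv (database a \<phi>)"
        by (fact init)
      fix J \<rho> h
      assume J: "?Inv J" and \<rho>: "\<rho> \<in> ?R" and "active_trigger J \<rho> h"
      then have "trigger J \<rho> h"
        by (simp add: active_trigger_def)
      moreover have "sound_rule M \<rho>"
        using \<rho> M assms(2) formula_rules_sound qdp_rule_sound by blast
      moreover have "finite \<gamma> \<and> terms \<gamma> \<subseteq> range var" if "\<gamma> \<in> head \<rho>" for \<gamma>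
        using that \<rho> formula_rules_finite_terms(2) qdp_rule_finite_terms(2) by blast
      ultimately show "\<exists>J'\<in>application J \<rho> h. ?Inv J'"
        using J ex_interpreted_application[of J M _ \<rho> h] by auto
    qed
    then obtain N S where S: "fair_derivation (database a \<phi>) ?R N S" "\<And>i. ?Inv (S i)"
      by blast
    then have "Contr \<in> (\<Union>i\<in>{i. enat i \<le> N}. S i)"
      using assms(3) unfolding Ch_def by blast
    then obtain i where "Contr \<in> S i"
      by blast
    with S(2)[of i] show False
      by (force simp: interprets_def)
  qed
qed

end
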